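(* Let $\ell^2$ be the Hilbert space of real-valued square-summable sequences, regarded as a Hilbert manifold (modelled on itself, with every tangent space $T_p\ell^2$ canonically identified with $\ell^2$). There exists a weak Riemannian metric $g$ on $\ell^2$ such that the associated geodesic pseudodistance $d_g$ vanishes identically, that is, $d_g(p,q)=0$ for all $p,q\in\ell^2$.
   Context: The space $\ell^2$ carries the standard scalar product $\langle x,y\rangle=\sum_{k\ge 1}x_ky_k$ and norm $\|x\|=\langle x,x\rangle^{1/2}$. A weak Riemannian metric on a (possibly infinite dimensional) manifold $M$ is a smooth symmetric tensor $g$ on $TM$ such that $g_p(v,v)>0$ for every $p\in M$ and every $v\in T_pM\setminus\{0\}$. It is not required that the map $T_pM\to (T_pM)^*$, $v\mapsto g_p(v,\cdot)$, be an isomorphism. For $M=\ell^2$ this means: $p\mapsto g_p$ is a smooth ($C^\infty$) map from $\ell^2$ to the Banach space of continuous symmetric bilinear forms $\ell^2\times\ell^2\to\mathbb{R}$, with $g_p(v,v)>0$ for all $p\in \ell^2$ and all $v\in\ell^2\setminus\{0\}$. For $p,q\in M$, let $\Gamma(p,q)$ be the class of all piecewise smooth curves $\gamma:[0,1]\to M$ with $\gamma(0)=p$ and $\gamma(1)=q$ (continuous curves for which there is a finite partition of $[0,1]$ such that $\gamma$ is smooth on each closed subinterval of the partition). The length of such a curve is $$L_g(\gamma)=\int_0^1\sqrt{g_{\gamma(t)}(\dot\gamma(t),\dot\gamma(t))}\,dt,$$ and the geodesic pseudodistance is $$d_g(p,q)=\inf\{L_g(\gamma):\gamma\in\Gamma(p,q)\}.$$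 *)

theory Defs
  imports "HOL-Analysis.Analysis"
begin

section \<open>The Hilbert space of square-summable real sequences\<close>

typedef ell2 = "{x :: nat \<Rightarrow> real. summable (\<lambda>k. (x k)\<^sup>2)}"
  morphisms coord Abs_ell2
  by (rule exI[of _ "\<lambda>_. 0"]) simp

setup_lifting type_definition_ell2

lemma summable_coord: "summable (\<lambda>k. (coord x k)\<^sup>2)"
  using coord by blast

lemma ell2_summable_mult:
  fixes x y :: "nat \<Rightarrow> real"
  assumes "summable (\<lambda>k. (x k)\<^sup>2)" "summable (\<lambda>k. (y k)\<^sup>2)"
  shows "summable (\<lambda>k. x k * y k)"
proof (rule summable_comparison_test)
  show "summable (\<lambda>k. (x k)\<^sup>2 + (y k)\<^sup>2)"
    by (intro summable_add assms)
  have "\<bar>a * b\<bar> \<le> a\<^sup>2 + b\<^sup>2" for a b :: real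
  proof -
    have "2 * (\<bar>a\<bar> * \<bar>b\<bar>) \<le> a\<^sup>2 + b\<^sup>2"
      using sum_squares_bound[of "\<bar>a\<bar>" "\<bar>b\<bar>"] by simp
    moreover have "0 \<le> \<bar>a\<bar> * \<bar>b\<bar>" by simp
    ultimately show ?thesis unfolding abs_mult by linarith
  qed
  then show "\<exists>N. \<forall>n\<ge>N. norm (x n * y n) \<le> (x n)\<^sup>2 + (y n)\<^sup>2"
    by simp
qed

lemma ell2_summable_add:
  fixes x y :: "nat \<Rightarrow> real"
  assumes "summable (\<lambda>k. (x k)\<^sup>2)" "summable (\<lambda>k. (y k)\<^sup>2)"
  shows "summable (\<lambda>k. (x k + y k)\<^sup>2)"
proof -
  have "summable (\<lambda>k. (x k)\<^sup>2 + (y k)\<^sup>2 + 2 * (x k * y k))"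
    by (intro summable_add summable_mult ell2_summable_mult assms)
  then show ?thesis by (simp add: power2_sum mult.assoc)
qed

lemma ell2_summable_scale:
  fixes x :: "nat \<Rightarrow> real"
  assumes "summable (\<lambda>k. (x k)\<^sup>2)"
  shows "summable (\<lambda>k. (c * x k)\<^sup>2)"
  using summable_mult[OF assms, of "c\<^sup>2"] by (simp add: power_mult_distrib)

instantiation ell2 :: real_vector
begin

lift_definition zero_ell2 :: ell2 is "\<lambda>_. 0" by simp

lift_definition plus_ell2 :: "ell2 \<Rightarrow> ell2 \<Rightarrow> ell2" is "\<lambda>x y k. x k + y k"
  by (rule ell2_summable_add)

lift_definition uminus_ell2 :: "ell2 \<Rightarrow> ell2" is "\<lambda>x k. - x k" by simp

lift_definition minus_ell2 :: "ell2 \<Rightarrow> ell2 \<Rightarrow> ell2" is "\<lambda>x y k. x k - y k"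
proof -
  fix x y :: "nat \<Rightarrow> real"
  assume "summable (\<lambda>k. (x k)\<^sup>2)" "summable (\<lambda>k. (y k)\<^sup>2)"
  then show "summable (\<lambda>k. (x k - y k)\<^sup>2)"
    using ell2_summable_add[of x "\<lambda>k. - y k"] by simp
qed

lift_definition scaleR_ell2 :: "real \<Rightarrow> ell2 \<Rightarrow> ell2" is "\<lambda>c x k. c * x k"
  by (rule ell2_summable_scale)

instance
  by standard (transfer; simp add: fun_eq_iff algebra_simps)+

end

instantiation ell2 :: real_inner
begin

definition inner_ell2 :: "ell2 \<Rightarrow> ell2 \<Rightarrow> real" where
  "inner_ell2 x y = (\<Sum>k. coord x k * coord y k)"

definition norm_ell2 :: "ell2 \<Rightarrow> real" where
  "norm_ell2 x = sqrt (inner x x)"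

definition dist_ell2 :: "ell2 \<Rightarrow> ell2 \<Rightarrow> real" where
  "dist_ell2 x y = norm (x - y)"

definition sgn_ell2 :: "ell2 \<Rightarrow> ell2" where
  "sgn_ell2 x = x /\<^sub>R norm x"

definition uniformity_ell2 :: "(ell2 \<times> ell2) filter" where
  "uniformity_ell2 = (INF e\<in>{0<..}. principal {(x, y). dist x y < e})"

definition open_ell2 :: "ell2 set \<Rightarrow> bool" where
  "open_ell2 U = (\<forall>x\<in>U. \<forall>\<^sub>F (x', y) in uniformity. x' = x \<longrightarrow> y \<in> U)"

instance
proof
  fix x y z :: ell2 and r :: real
  have s: "summable (\<lambda>k. coord a k * coord b k)" for a b
    by (intro ell2_summable_mult summable_coord)
  show "inner x y = inner y x"
    by (simp add: inner_ell2_def mult.commute)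
  show "inner (x + y) z = inner x z + inner y z"
    by (simp add: inner_ell2_def plus_ell2.rep_eq distrib_right suminf_add s)
  show "inner (r *\<^sub>R x) y = r * inner x y"
    by (simp add: inner_ell2_def scaleR_ell2.rep_eq mult.assoc suminf_mult s)
  show "0 \<le> inner x x"
    unfolding inner_ell2_def by (intro suminf_nonneg s) simp
  have "inner x x = 0 \<longleftrightarrow> (\<forall>k. coord x k * coord x k = 0)"
    unfolding inner_ell2_def by (rule suminf_eq_zero_iff[OF s]) simp
  also have "\<dots> \<longleftrightarrow> x = 0"
    by (auto simp: coord_inject[symmetric] zero_ell2.rep_eq fun_eq_iff)
  finally show "inner x x = 0 \<longleftrightarrow> x = 0" .
qed (simp_all add: norm_ell2_def dist_ell2_def sgn_ell2_def uniformity_ell2_def open_ell2_def)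

end

lemma norm_ell2_power2: "(norm x)\<^sup>2 = (\<Sum>k. (coord x k)\<^sup>2)" for x :: ell2
  unfolding power2_norm_eq_inner inner_ell2_def by (simp add: power2_eq_square)

lemma sum_coord_le_norm: "(\<Sum>k<K. (coord x k)\<^sup>2) \<le> (norm x)\<^sup>2"
  unfolding norm_ell2_power2 by (intro sum_le_suminf summable_coord) auto

lemma abs_coord_le_norm: "\<bar>coord x k\<bar> \<le> norm x"
proof -
  have "(coord x k)\<^sup>2 \<le> (\<Sum>i<Suc k. (coord x i)\<^sup>2)"
    by (simp add: sum_nonneg)
  also have "\<dots> \<le> (norm x)\<^sup>2" by (rule sum_coord_le_norm)
  finally show ?thesis by (simp add: abs_le_square_iff[symmetric])
qed

instance ell2 :: banach
proof
  fix X :: "nat \<Rightarrow> ell2"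
  assume X: "Cauchy X"
  have "Cauchy (\<lambda>n. coord (X n) k)" for k
  proof (rule metric_CauchyI)
    fix e :: real assume "e > 0"
    then obtain M where M: "\<forall>m\<ge>M. \<forall>n\<ge>M. dist (X m) (X n) < e"
      using X metric_CauchyD by blast
    have "dist (coord (X m) k) (coord (X n) k) \<le> dist (X m) (X n)" for m n
      using abs_coord_le_norm[of "X m - X n" k]
      by (simp add: dist_real_def dist_norm minus_ell2.rep_eq)
    then show "\<exists>M. \<forall>m\<ge>M. \<forall>n\<ge>M. dist (coord (X m) k) (coord (X n) k) < e"
      using M by (meson order_le_less_trans)
  qed
  then have "\<forall>k. \<exists>l. (\<lambda>n. coord (X n) k) \<longlonglongrightarrow> l"
    using Cauchy_convergent convergent_def by blast
  then obtain y where y: "(\<lambda>n. coord (X n) k) \<longlonglongrightarrow> y k" for k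
    by metis
  have tail: "\<exists>M. \<forall>m\<ge>M. \<forall>K. (\<Sum>k<K. (coord (X m) k - y k)\<^sup>2) \<le> e\<^sup>2" if "e > 0" for e :: real
  proof -
    obtain M where M: "dist (X m) (X n) < e" if "m \<ge> M" "n \<ge> M" for m n
      using X metric_CauchyD \<open>e > 0\<close> by blast
    have "(\<Sum>k<K. (coord (X m) k - y k)\<^sup>2) \<le> e\<^sup>2" if m: "m \<ge> M" for m K
    proof (rule LIMSEQ_le_const2)
      show "(\<lambda>n. \<Sum>k<K. (coord (X m) k - coord (X n) k)\<^sup>2) \<longlonglongrightarrow> (\<Sum>k<K. (coord (X m) k - y k)\<^sup>2)"
        by (intro tendsto_intros y)
      have "(\<Sum>k<K. (coord (X m) k - coord (X n) k)\<^sup>2) \<le> e\<^sup>2" if n: "n \<ge> M" for n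
      proof -
        have "(\<Sum>k<K. (coord (X m) k - coord (X n) k)\<^sup>2) \<le> (norm (X m - X n))\<^sup>2"
          using sum_coord_le_norm[of "X m - X n" K] by (simp add: minus_ell2.rep_eq)
        also have "\<dots> \<le> e\<^sup>2"
          using M[OF m n] by (intro power_mono) (auto simp: dist_norm)
        finally show ?thesis .
      qed
      then show "\<exists>N. \<forall>n\<ge>N. (\<Sum>k<K. (coord (X m) k - coord (X n) k)\<^sup>2) \<le> e\<^sup>2"
        by blast
    qed
    then show ?thesis by blast
  qed
  have summ: "summable (\<lambda>k. (coord (X m) k - y k)\<^sup>2)"
    if "\<forall>K. (\<Sum>k<K. (coord (X m) k - y k)\<^sup>2) \<le> e\<^sup>2" for m and e :: real
    by (rule summableI_nonneg_bounded[where x = "e\<^sup>2"]) (use that in auto)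
  obtain m0 where "\<forall>K. (\<Sum>k<K. (coord (X m0) k - y k)\<^sup>2) \<le> 1\<^sup>2"
    using tail[of 1] by auto
  from ell2_summable_add[OF summable_coord[of "X m0"] ell2_summable_scale[OF summ[OF this], of "-1"]]
  have "summable (\<lambda>k. (y k)\<^sup>2)" by simp
  then have Y: "coord (Abs_ell2 y) = y"
    by (simp add: Abs_ell2_inverse)
  have "X \<longlonglongrightarrow> Abs_ell2 y"
  proof (rule metric_LIMSEQ_I)
    fix r :: real assume "r > 0"
    then obtain M where M: "\<forall>m\<ge>M. \<forall>K. (\<Sum>k<K. (coord (X m) k - y k)\<^sup>2) \<le> (r / 2)\<^sup>2"
      using tail[of "r / 2"] by auto
    have "dist (X m) (Abs_ell2 y) < r" if "m \<ge> M" for m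
    proof -
      have "(norm (X m - Abs_ell2 y))\<^sup>2 = (\<Sum>k. (coord (X m) k - y k)\<^sup>2)"
        by (simp add: norm_ell2_power2 minus_ell2.rep_eq Y)
      also have "\<dots> \<le> (r / 2)\<^sup>2"
        using M that by (intro suminf_le_const summ) auto
      finally have "norm (X m - Abs_ell2 y) \<le> r / 2"
        by (rule power2_le_imp_le) (use \<open>r > 0\<close> in simp)
      then show ?thesis using \<open>r > 0\<close> by (simp add: dist_norm)
    qed
    then show "\<exists>M. \<forall>m\<ge>M. dist (X m) (Abs_ell2 y) < r" by blast
  qed
  then show "convergent X" by (auto simp: convergent_def)
qed


section \<open>Smooth maps between normed spaces\<close>

text \<open>A multilinear map in \<open>k\<close> arguments is represented by a function on lists, of which only
  the values on lists of length \<open>k\<close> matter.  The bound \<open>C\<close> expresses continuity.\<close>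

definition bounded_multilinear ::
    "nat \<Rightarrow> ('a::real_normed_vector list \<Rightarrow> 'b::real_normed_vector) \<Rightarrow> bool" where
  "bounded_multilinear k m \<longleftrightarrow>
     (\<forall>vs i. length vs = k \<longrightarrow> i < k \<longrightarrow> linear (\<lambda>v. m (vs[i := v]))) \<and>
     (\<exists>C. \<forall>vs. length vs = k \<longrightarrow> norm (m vs) \<le> C * prod_list (map norm vs))"

text \<open>\<open>multilinear_deriv k F m' x\<close>: the map \<open>F\<close> into the \<open>k\<close>-linear maps, normed by the operator
  norm, has at \<open>x\<close> the Frechet derivative \<open>h \<mapsto> m' (h, _, \<dots>, _)\<close>.  The condition on \<open>vs\<close> says
  that the operator norm of \<open>F (x + h) - F x - m' (h, _, \<dots>, _)\<close> is at most \<open>e * norm h\<close>.\<close>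

definition multilinear_deriv ::
    "nat \<Rightarrow> ('a::real_normed_vector \<Rightarrow> 'a list \<Rightarrow> 'b::real_normed_vector)
      \<Rightarrow> ('a list \<Rightarrow> 'b) \<Rightarrow> 'a \<Rightarrow> bool" where
  "multilinear_deriv k F m' x \<longleftrightarrow>
     (\<forall>e>0. \<exists>d>0. \<forall>h. norm h < d \<longrightarrow>
        (\<forall>vs. length vs = k \<longrightarrow>
           norm (F (x + h) vs - F x vs - m' (h # vs)) \<le> e * norm h * prod_list (map norm vs)))"

text \<open>\<open>D k\<close> is the \<open>k\<close>-th Frechet derivative of \<open>f\<close>.  Its continuity is automatic, because it is
  itself differentiable.\<close>

definition smooth_map :: "('a::real_normed_vector \<Rightarrow> 'b::real_normed_vector) \<Rightarrow> bool" where
  "smooth_map f \<longleftrightarrow>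
     (\<exists>D :: nat \<Rightarrow> 'a \<Rightarrow> 'a list \<Rightarrow> 'b.
        (\<forall>x. D 0 x [] = f x) \<and>
        (\<forall>k x. bounded_multilinear k (D k x)) \<and>
        (\<forall>k x. multilinear_deriv k (D k) (D (Suc k) x) x))"

lemma smooth_map_has_derivative:
  fixes f :: "'a::real_normed_vector \<Rightarrow> 'b::real_normed_vector"
  assumes "smooth_map f"
  shows "\<exists>f'. (f has_derivative f') (at x)"
proof -
  obtain D :: "nat \<Rightarrow> 'a \<Rightarrow> 'a list \<Rightarrow> 'b" where D0: "\<And>x. D 0 x [] = f x"
    and ml: "\<And>k x. bounded_multilinear k (D k x)"
    and der: "\<And>k x. multilinear_deriv k (D k) (D (Suc k) x) x"
    using assms unfolding smooth_map_def by blast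
  have lin: "linear (\<lambda>v. D 1 x [v])"
  proof -
    have "linear (\<lambda>v. D 1 x ([0][0 := v]))"
      using ml[of 1 x] unfolding bounded_multilinear_def by (metis One_nat_def length_Cons list.size(3) zero_less_one)
    then show ?thesis by simp
  qed
  obtain C where C: "\<And>vs. length vs = 1 \<Longrightarrow> norm (D 1 x vs) \<le> C * prod_list (map norm vs)"
    using ml[of 1 x] unfolding bounded_multilinear_def by blast
  have "bounded_linear (\<lambda>v. D 1 x [v])"
  proof (rule bounded_linear_intro)
    show "norm (D 1 x [v]) \<le> norm v * C" for v
      using C[of "[v]"] by (simp add: mult.commute)
  qed (use linear_add[OF lin] linear_scale[OF lin] in auto)
  moreover have "\<exists>d>0. \<forall>y. norm (y - x) < d \<longrightarrow>
      norm (f y - f x - D 1 x [y - x]) \<le> e * norm (y - x)" if "e > 0" for e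
  proof -
    obtain d where d: "d > 0"
      "\<And>h. norm h < d \<Longrightarrow> norm (D 0 (x + h) [] - D 0 x [] - D (Suc 0) x [h]) \<le> e * norm h"
      using der[of 0 x] \<open>e > 0\<close> unfolding multilinear_deriv_def by auto
    have "norm (f y - f x - D 1 x [y - x]) \<le> e * norm (y - x)" if "norm (y - x) < d" for y
      using d(2)[OF that] by (simp add: D0)
    then show ?thesis using d(1) by blast
  qed
  ultimately show ?thesis
    unfolding has_derivative_at_alt by blast
qed


section \<open>Weak Riemannian metrics and geodesic pseudodistance\<close>

text \<open>For a normed space \<open>'a\<close>, the continuous bilinear forms are the elements of
  \<open>'a \<Rightarrow>\<^sub>L 'a \<Rightarrow>\<^sub>L real\<close>, with the same norm.\<close>

definition weak_riemannian_metric ::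
    "('a::real_normed_vector \<Rightarrow> 'a \<Rightarrow>\<^sub>L 'a \<Rightarrow>\<^sub>L real) \<Rightarrow> bool" where
  "weak_riemannian_metric g \<longleftrightarrow>
     smooth_map g \<and>
     (\<forall>p u v. blinfun_apply (blinfun_apply (g p) u) v = blinfun_apply (blinfun_apply (g p) v) u) \<and>
     (\<forall>p v. v \<noteq> 0 \<longrightarrow> blinfun_apply (blinfun_apply (g p) v) v > 0)"

text \<open>Derivatives at the endpoints of the interval are one-sided.\<close>

definition smooth_curve_on :: "(real \<Rightarrow> 'a::real_normed_vector) \<Rightarrow> real \<Rightarrow> real \<Rightarrow> bool" where
  "smooth_curve_on \<gamma> a b \<longleftrightarrow>
     (\<exists>D :: nat \<Rightarrow> real \<Rightarrow> 'a.
        (\<forall>t\<in>{a..b}. D 0 t = \<gamma> t) \<and>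
        (\<forall>k. \<forall>t\<in>{a..b}. (D k has_vector_derivative D (Suc k) t) (at t within {a..b})))"

definition piecewise_smooth_path :: "(real \<Rightarrow> 'a::real_normed_vector) \<Rightarrow> bool" where
  "piecewise_smooth_path \<gamma> \<longleftrightarrow>
     path \<gamma> \<and>
     (\<exists>n (s :: nat \<Rightarrow> real). s 0 = 0 \<and> s n = 1 \<and>
        (\<forall>i<n. s i < s (Suc i) \<and> smooth_curve_on \<gamma> (s i) (s (Suc i))))"

definition piecewise_smooth_paths ::
    "'a::real_normed_vector \<Rightarrow> 'a \<Rightarrow> (real \<Rightarrow> 'a) set" where
  "piecewise_smooth_paths p q =
     {\<gamma>. piecewise_smooth_path \<gamma> \<and> pathstart \<gamma> = p \<and> pathfinish \<gamma> = q}"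

text \<open>The velocity is unspecified at the finitely many break points, which does not affect the
  integral.  Away from them the integrand is piecewise continuous, hence integrable.\<close>

definition curve_length ::
    "('a::real_normed_vector \<Rightarrow> 'a \<Rightarrow>\<^sub>L 'a \<Rightarrow>\<^sub>L real) \<Rightarrow> (real \<Rightarrow> 'a) \<Rightarrow> real" where
  "curve_length g \<gamma> =
     integral {0..1} (\<lambda>t. let v = vector_derivative \<gamma> (at t within {0..1})
                          in sqrt (blinfun_apply (blinfun_apply (g (\<gamma> t)) v) v))"

definition geodesic_dist ::
    "('a::real_normed_vector \<Rightarrow> 'a \<Rightarrow>\<^sub>L 'a \<Rightarrow>\<^sub>L real) \<Rightarrow> 'a \<Rightarrow> 'a \<Rightarrow> real" where
  "geodesic_dist g p q = (INF \<gamma>\<in>piecewise_smooth_paths p q. curve_length g \<gamma>)"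

text \<open>The infimum is over a nonempty set that is bounded below.\<close>

lemma linepath_in_piecewise_smooth_paths: "linepath p q \<in> piecewise_smooth_paths p q"
proof -
  let ?D = "\<lambda>k t. if k = 0 then linepath p q t else if k = Suc 0 then q - p else 0"
  have "smooth_curve_on (linepath p q) 0 1"
    unfolding smooth_curve_on_def
  proof (intro exI[of _ ?D] conjI allI ballI)
    fix k :: nat and t :: real
    show "(?D k has_vector_derivative ?D (Suc k) t) (at t within {0..1})"
      by (cases "k = 0") (auto intro: has_vector_derivative_linepath_within)
  qed simp
  then show ?thesis
    unfolding piecewise_smooth_paths_def piecewise_smooth_path_def
    by (auto intro!: exI[of _ "1::nat"] exI[of _ real])
qed

lemma curve_length_nonneg:
  assumes "weak_riemannian_metric g"
  shows "curve_length g \<gamma> \<ge> 0"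
proof -
  have "blinfun_apply (blinfun_apply (g p) v) v \<ge> 0" for p v
    using assms unfolding weak_riemannian_metric_def
    by (cases "v = 0") (auto simp: less_imp_le)
  then show ?thesis
    unfolding curve_length_def Let_def
    by (cases "(\<lambda>t. sqrt (blinfun_apply (blinfun_apply (g (\<gamma> t))
          (vector_derivative \<gamma> (at t within {0..1}))) (vector_derivative \<gamma> (at t within {0..1}))))
        integrable_on {0..1}")
      (auto intro: integral_nonneg simp: not_integrable_integral)
qed

lemma bdd_below_curve_length:
  assumes "weak_riemannian_metric g"
  shows "bdd_below (curve_length g ` piecewise_smooth_paths p q)"
  using curve_length_nonneg[OF assms] by (intro bdd_belowI2[of _ 0]) auto

end

theory Submission
  imports Defs
begin

text \<open>The metric is \<open>g\<^sub>x(v, v) = exp (L x) \<cdot> \<parallel>T v\<parallel>\<^sup>2\<close> with the functional \<open>L x = (\<Sum>k. 2\<^sup>-\<^sup>k x\<^sub>k)\<close> and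
  the injective compact operator \<open>T x = (4\<^sup>-\<^sup>k x\<^sub>k)\<^sub>k\<close>.  A detour from \<open>p\<close> to \<open>q\<close> by the vector
  \<open>-4\<^sup>n t (1 - t) e\<^sub>n\<close> contributes a velocity that \<open>T\<close> maps into the unit ball, but multiplies the
  conformal factor by \<open>exp (-2\<^sup>n t (1 - t))\<close>.  Hence the length tends to 0 by dominated
  convergence.\<close>

section \<open>Smoothness of the exponential of a bounded linear functional\<close>

lemma norm_prod_list_map_le:
  fixes L :: "'a::real_normed_vector \<Rightarrow> real"
  assumes "\<And>v. \<bar>L v\<bar> \<le> norm v * K" "K \<ge> 0"
  shows "\<bar>prod_list (map L vs)\<bar> \<le> K ^ length vs * prod_list (map norm vs)"
proof (induction vs)
  case (Cons v vs)
  have "\<bar>L v\<bar> * \<bar>prod_list (map L vs)\<bar> \<le> (norm v * K) * (K ^ length vs * prod_list (map norm vs))"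
    by (intro mult_mono assms Cons) (use assms(2) in auto)
  then show ?case by (simp add: abs_mult mult_ac)
qed simp

text \<open>With every slot but \<open>i\<close> frozen, the product is a fixed scalar times
  \<open>L v\<close>.\<close>

lemma linear_prod_list_map_update:
  fixes L :: "'a::real_vector \<Rightarrow> real"
  assumes "linear L" "i < length vs"
  shows "linear (\<lambda>v. prod_list (map L (vs[i := v])))"
proof -
  have "prod_list (map L (vs[i := v])) =
      (prod_list (map L (take i vs)) * prod_list (map L (drop (Suc i) vs))) *\<^sub>R L v" for v
    using assms(2) by (simp add: upd_conv_take_nth_drop mult_ac)
  then show ?thesis
    using linear_compose_scale_right[OF assms(1)] by simp
qed

text \<open>All derivatives are explicit: the \<open>k\<close>-th one sends \<open>vs\<close> to
  \<open>exp (L x)\<close> times the product of the values \<open>L v\<close>, times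
  \<open>b\<close>. At each order the remainder is therefore the first-order remainder of
  \<open>exp (L x)\<close> times a product form of operator norm at most
  \<open>K ^ k\<close>.\<close>

lemma smooth_map_exp_linear_scaleR:
  fixes L :: "'a::real_normed_vector \<Rightarrow> real" and b :: "'b::real_normed_vector"
  assumes L: "bounded_linear L"
  shows "smooth_map (\<lambda>x. exp (L x) *\<^sub>R b)"
  unfolding smooth_map_def
proof (intro exI conjI allI)
  let ?D = "\<lambda>k x vs. (exp (L x) * prod_list (map L vs)) *\<^sub>R b"
  obtain K where K: "K \<ge> 0" "\<And>v. \<bar>L v\<bar> \<le> norm v * K"
    using bounded_linear.nonneg_bounded[OF L] by auto
  note P = norm_prod_list_map_le[of L K, OF K(2,1)]
  show "?D 0 x [] = exp (L x) *\<^sub>R b" for x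
    by simp
  show "bounded_multilinear k (?D k x)" for k x
    unfolding bounded_multilinear_def
  proof (intro conjI allI impI)
    fix vs :: "'a list" and i assume "length vs = k" "i < k"
    then have "linear (\<lambda>v. prod_list (map L (vs[i := v])))"
      by (intro linear_prod_list_map_update bounded_linear.linear[OF L]) simp
    then show "linear (\<lambda>v. ?D k x (vs[i := v]))"
      by (simp add: linear_iff algebra_simps)
  next
    have "norm (?D k x vs) \<le> exp (L x) * K ^ k * norm b * prod_list (map norm vs)"
      if "length vs = k" for vs
    proof -
      have "norm (?D k x vs) = \<bar>prod_list (map L vs)\<bar> * (exp (L x) * norm b)"
        by (simp add: abs_mult)
      also have "\<dots> \<le> (K ^ k * prod_list (map norm vs)) * (exp (L x) * norm b)"
        using P[of vs] that by (intro mult_right_mono) auto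
      finally show ?thesis by (simp add: mult_ac)
    qed
    then show "\<exists>C. \<forall>vs. length vs = k \<longrightarrow> norm (?D k x vs) \<le> C * prod_list (map norm vs)"
      by blast
  qed
  show "multilinear_deriv k (?D k) (?D (Suc k) x) x" for k x
    unfolding multilinear_deriv_def
  proof (intro allI impI)
    fix e :: real assume "e > 0"
    \<comment> \<open>The tolerance \<open>e / M\<close> will absorb the factor
      \<open>K ^ k * norm b\<close>; the summand 1 makes the division safe when that factor is
      0.\<close>
    define M where "M = K ^ k * norm b + 1"
    have M: "M > 0" "K ^ k * norm b \<le> M"
      using K(1) by (auto simp: M_def add_nonneg_pos)
    have "((\<lambda>x. exp (L x)) has_derivative (\<lambda>h. exp (L x) * L h)) (at x)"
      by (auto intro!: derivative_eq_intros bounded_linear.has_derivative[OF L])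
    then obtain d where d: "d > 0"
      "\<And>y. norm (y - x) < d \<Longrightarrow>
        norm (exp (L y) - exp (L x) - exp (L x) * L (y - x)) \<le> e / M * norm (y - x)"
      unfolding has_derivative_at_alt using \<open>e > 0\<close> M(1) by (meson divide_pos_pos)
    have "norm (?D k (x + h) vs - ?D k x vs - ?D (Suc k) x (h # vs))
        \<le> e * norm h * prod_list (map norm vs)"
      if h: "norm h < d" and vs: "length vs = k" for h vs
    proof -
      have N: "0 \<le> prod_list (map norm vs)"
        by (induction vs) auto
      have "?D k (x + h) vs - ?D k x vs - ?D (Suc k) x (h # vs) =
          ((exp (L (x + h)) - exp (L x) - exp (L x) * L h) * prod_list (map L vs)) *\<^sub>R b"
        by (simp add: algebra_simps)
      then have "norm (?D k (x + h) vs - ?D k x vs - ?D (Suc k) x (h # vs)) =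
          \<bar>exp (L (x + h)) - exp (L x) - exp (L x) * L h\<bar> * \<bar>prod_list (map L vs)\<bar> * norm b"
        by (simp add: abs_mult)
      also have "\<dots> \<le> (e / M * norm h) * (K ^ k * prod_list (map norm vs)) * norm b"
        using d(2)[of "x + h"] h P[of vs] vs \<open>e > 0\<close> M(1)
        by (intro mult_right_mono mult_mono) auto
      also have "\<dots> = (e / M * norm h * prod_list (map norm vs)) * (K ^ k * norm b)"
        by simp
      also have "\<dots> \<le> (e / M * norm h * prod_list (map norm vs)) * M"
        using M \<open>e > 0\<close> N by (intro mult_left_mono) auto
      also have "\<dots> = e * norm h * prod_list (map norm vs)"
        using M(1) by simp
      finally show ?thesis .
    qed
    with d(1) show "\<exists>d>0. \<forall>h. norm h < d \<longrightarrow> (\<forall>vs. length vs = k \<longrightarrow>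
        norm (?D k (x + h) vs - ?D k x vs - ?D (Suc k) x (h # vs))
          \<le> e * norm h * prod_list (map norm vs))"
      by blast
  qed
qed

section \<open>Parabolic detours and their exponential weights\<close>

definition parabola :: "'a::real_normed_vector \<Rightarrow> 'a \<Rightarrow> 'a \<Rightarrow> real \<Rightarrow> 'a" where
  "parabola p q u t = p + t *\<^sub>R (q - p) - (t * (1 - t)) *\<^sub>R u"

lemma has_vector_derivative_parabola:
  "(parabola p q u has_vector_derivative q - p - (1 - 2 * t) *\<^sub>R u) (at t within S)"
  unfolding parabola_def
  by (auto intro!: derivative_eq_intros simp: algebra_simps simp flip: scaleR_add_left)

lemma parabola_in_piecewise_smooth_paths: "parabola p q u \<in> piecewise_smooth_paths p q"
proof -
  let ?D = "\<lambda>k t. if k = 0 then parabola p q u t else if k = 1 then q - p - (1 - 2 * t) *\<^sub>R u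
    else if k = 2 then 2 *\<^sub>R u else 0"
  have "(?D k has_vector_derivative ?D (Suc k) t) (at t within {0..1})" for k :: nat and t
  proof -
    consider "k = 0" | "k = 1" | "k \<ge> 2" by linarith
    then show ?thesis
    proof cases
      case 1
      then show ?thesis by (simp add: has_vector_derivative_parabola)
    next
      case 2
      then show ?thesis by (auto intro!: derivative_eq_intros)
    qed auto
  qed
  then have "smooth_curve_on (parabola p q u) 0 1"
    unfolding smooth_curve_on_def by (intro exI[of _ ?D]) simp
  moreover have "path (parabola p q u)"
    unfolding path_def parabola_def by (intro continuous_intros)
  ultimately show ?thesis
    unfolding piecewise_smooth_paths_def piecewise_smooth_path_def
    \<comment> \<open>The trivial partition: one piece, with break points \<open>real 0 = 0\<close>
      and \<open>real 1 = 1\<close>.\<close>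
    by (auto intro!: exI[of _ "1::nat"] exI[of _ real]
        simp: pathstart_def pathfinish_def parabola_def)
qed

lemma integral_exp_parabola_tendsto_0:
  assumes c: "filterlim c at_top sequentially" "\<And>n. c n \<ge> 0"
  shows "(\<lambda>n. integral {0..1} (\<lambda>t. exp (- (c n * (t * (1 - t)))))) \<longlonglongrightarrow> (0::real)"
proof -
  let ?f = "\<lambda>n t. exp (- (c n * (t * (1 - t)))) :: real"
  \<comment> \<open>At the endpoints \<open>t * (1 - t)\<close> vanishes, so the integrand stays 1
    there for every \<open>n\<close>; this two-point set is negligible for the integral.\<close>
  let ?g = "\<lambda>t::real. if t \<in> {0, 1} then 1 else 0 :: real"
  have lim: "(\<lambda>n. ?f n t) \<longlonglongrightarrow> ?g t" if "t \<in> {0..1}" for t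
  proof (cases "t \<in> {0, 1}")
    case False
    then have "t * (1 - t) > 0" using that by auto
    then have "filterlim (\<lambda>n. c n * (t * (1 - t))) at_top sequentially"
      by (intro filterlim_at_top_mult_tendsto_pos[OF tendsto_const _ c(1)])
    then show ?thesis
      using False
      by (auto intro!: filterlim_compose[OF exp_at_bot] simp: filterlim_uminus_at_top)
  qed auto
  have "(\<lambda>n. integral {0..1} (?f n)) \<longlonglongrightarrow> integral {0..1} ?g"
  proof (rule dominated_convergence(2)[where h = "\<lambda>_. 1"])
    show "?f n integrable_on {0..1}" for n
      by (intro integrable_continuous_interval continuous_intros)
    show "norm (?f n t) \<le> 1" if "t \<in> {0..1}" for n t
      using that c(2)[of n] by simp
  qed (use lim in auto)
  moreover have "integral {0..1} ?g = integral {0..1} (\<lambda>_::real. 0)"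
    by (rule integral_spike[of "{0, 1 :: real}"]) auto
  ultimately show ?thesis by simp
qed

section \<open>The functional, the unit vectors and the damping operator\<close>

lift_definition geometric :: ell2 is "\<lambda>k. (1 / 2) ^ k"
proof -
  have "(\<lambda>k. ((1 / 2 :: real) ^ k)\<^sup>2) = (\<lambda>k. (1 / 4) ^ k)"
    by (simp add: fun_eq_iff power2_eq_square flip: power_mult_distrib)
  then show "summable (\<lambda>k. ((1 / 2 :: real) ^ k)\<^sup>2)" by (simp add: summable_geometric)
qed

lift_definition unit_vec :: "nat \<Rightarrow> ell2" is "\<lambda>n k. if k = n then 1 else 0"
  by (rule summable_finite[of "{n}" for n]) auto

lemma damp_square_le: "((1 / 4) ^ k * x)\<^sup>2 \<le> (x::real)\<^sup>2"
proof -
  have "\<bar>(1 / 4) ^ k * x\<bar> \<le> 1 * \<bar>x\<bar>"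
    unfolding abs_mult by (intro mult_right_mono) (auto simp: power_le_one)
  then show ?thesis by (simp add: abs_le_square_iff)
qed

lift_definition damp :: "ell2 \<Rightarrow> ell2" is "\<lambda>x k. (1 / 4) ^ k * x k"
  by (rule summable_comparison_test, intro exI allI impI) (use damp_square_le in auto)

lemma norm_damp_le: "norm (damp x) \<le> norm x"
proof (rule power2_le_imp_le)
  show "(norm (damp x))\<^sup>2 \<le> (norm x)\<^sup>2"
    unfolding norm_ell2_power2
    by (intro suminf_le summable_coord) (simp add: damp.rep_eq damp_square_le)
qed simp

lemma bounded_linear_damp: "bounded_linear damp"
proof (rule bounded_linear_intro[where K = 1])
  show "damp (x + y) = damp x + damp y" for x y
    by transfer (simp add: algebra_simps)
  show "damp (r *\<^sub>R x) = r *\<^sub>R damp x" for r x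
    by transfer (simp add: algebra_simps)
qed (simp add: norm_damp_le)

text \<open>Injectivity makes the form positive definite. Since \<open>damp\<close> shrinks the unit
  vectors to 0, it is not bounded below, so the metric is only weak.\<close>

lemma damp_eq_0_iff: "damp x = 0 \<longleftrightarrow> x = 0"
  by transfer (simp add: fun_eq_iff)

lemma inner_unit_vec: "inner x (unit_vec n) = coord x n"
proof -
  have "(\<lambda>k. coord x k * coord (unit_vec n) k) sums coord x n"
    using sums_single[of n "coord x"] by (simp add: unit_vec.rep_eq if_distrib cong: if_cong)
  then show ?thesis by (simp add: inner_ell2_def sums_iff)
qed

text \<open>The eigenvalue \<open>(1 / 4) ^ n\<close> is what cancels the height
  \<open>4 ^ n\<close> of the detour.\<close>

lemma damp_unit_vec: "damp (unit_vec n) = (1 / 4) ^ n *\<^sub>R unit_vec n"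
  by transfer auto

lemma norm_unit_vec: "norm (unit_vec n) = 1"
  by (simp add: norm_eq_sqrt_inner inner_unit_vec) (simp add: unit_vec.rep_eq)

section \<open>The conformal metric and the lengths of the detours\<close>

lift_definition damped_inner :: "ell2 \<Rightarrow>\<^sub>L ell2 \<Rightarrow>\<^sub>L real" is
  "\<lambda>u. blinfun_inner_right (damp u) o\<^sub>L Blinfun damp"
  by (intro bounded_linear_intros bounded_linear_damp)

lemma damped_inner_apply:
  "blinfun_apply (blinfun_apply damped_inner u) v = inner (damp u) (damp v)"
  by (simp add: damped_inner.rep_eq bounded_linear_Blinfun_apply[OF bounded_linear_damp])

text \<open>The vector \<open>geometric\<close> is the Riesz representative of the functional
  \<open>L\<close>. The form \<open>damped_inner\<close> does not depend on the point, so smoothness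
  concerns only the scalar factor.\<close>

definition exp_metric :: "ell2 \<Rightarrow> ell2 \<Rightarrow>\<^sub>L ell2 \<Rightarrow>\<^sub>L real" where
  "exp_metric x = exp (inner geometric x) *\<^sub>R damped_inner"

lemma exp_metric_apply:
  "blinfun_apply (blinfun_apply (exp_metric x) u) v = exp (inner geometric x) * inner (damp u) (damp v)"
  by (simp add: exp_metric_def scaleR_blinfun.rep_eq damped_inner_apply)

lemma sqrt_exp_metric: "sqrt (blinfun_apply (blinfun_apply (exp_metric x) v) v) =
    exp (inner geometric x / 2) * norm (damp v)"
proof -
  have "sqrt (exp (inner geometric x)) = exp (inner geometric x / 2)"
    by (rule real_sqrt_unique) (simp_all add: power2_eq_square flip: exp_add)
  then show ?thesis
    by (simp add: exp_metric_apply real_sqrt_mult norm_eq_sqrt_inner)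
qed

lemma weak_riemannian_metric_exp_metric: "weak_riemannian_metric exp_metric"
  unfolding weak_riemannian_metric_def
proof (intro conjI allI impI)
  show "smooth_map exp_metric"
    unfolding exp_metric_def by (intro smooth_map_exp_linear_scaleR bounded_linear_inner_right)
qed (simp_all add: exp_metric_apply inner_commute damp_eq_0_iff)

text \<open>The functional and the operator scale the detour differently: \<open>4 ^ n\<close> times
  the \<open>n\<close>-th unit vector has \<open>L\<close>-value \<open>2 ^ n\<close>, yet
  \<open>damp\<close> maps it to norm 1. The constant in front of the integral is thus free of
  \<open>n\<close>, while the exponent grows.\<close>

lemma curve_length_parabola_le:
  "curve_length exp_metric (parabola p q (4 ^ n *\<^sub>R unit_vec n)) \<le>
    exp (norm geometric * (norm p + norm (q - p)) / 2) * (norm (q - p) + 1) *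
      integral {0..1} (\<lambda>t. exp (- (2 ^ n / 2 * (t * (1 - t)))))"
proof -
  let ?u = "4 ^ n *\<^sub>R unit_vec n"
  let ?v = "\<lambda>t. q - p - (1 - 2 * t) *\<^sub>R ?u"
  let ?h = "\<lambda>t. exp (inner geometric (parabola p q ?u t) / 2) * norm (damp (?v t))"
  let ?K = "exp (norm geometric * (norm p + norm (q - p)) / 2) * (norm (q - p) + 1)"
  have "vector_derivative (parabola p q ?u) (at t within {0..1}) = ?v t" if "t \<in> {0..1}" for t
    using that unfolding box_real(2)[symmetric]
    by (intro vector_derivative_within_cbox has_vector_derivative_parabola) simp_all
  then have "curve_length exp_metric (parabola p q ?u) = integral {0..1} ?h"
    unfolding curve_length_def Let_def sqrt_exp_metric by (intro integral_cong) simp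
  also have "\<dots> \<le> integral {0..1} (\<lambda>t. ?K * exp (- (2 ^ n / 2 * (t * (1 - t)))))"
  proof (rule integral_le)
    show "?h integrable_on {0..1}"
      unfolding parabola_def
      by (intro integrable_continuous_interval continuous_intros
          bounded_linear.continuous_on[OF bounded_linear_damp]) simp_all
    show "(\<lambda>t. ?K * exp (- (2 ^ n / 2 * (t * (1 - t))))) integrable_on {0..1}"
      by (intro integrable_continuous_interval continuous_intros)
  next
    fix t :: real assume t: "t \<in> {0..1}"
    \<comment> \<open>The straight part of the curve stays in a fixed ball, so it contributes a
      factor bounded independently of \<open>n\<close> and \<open>t\<close>.\<close>
    have "inner geometric (p + t *\<^sub>R (q - p)) \<le> norm geometric * norm (p + t *\<^sub>R (q - p))"
      by (rule norm_cauchy_schwarz)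
    also have "norm (p + t *\<^sub>R (q - p)) \<le> norm p + norm (t *\<^sub>R (q - p))"
      by (rule norm_triangle_ineq)
    also have "norm (t *\<^sub>R (q - p)) \<le> norm (q - p)"
      using t by (simp add: mult_left_le_one_le)
    finally have 1: "inner geometric (p + t *\<^sub>R (q - p)) \<le> norm geometric * (norm p + norm (q - p))"
      by (simp add: mult_left_mono)
    have "inner geometric ?u = 2 ^ n"
      by (simp add: inner_unit_vec geometric.rep_eq flip: power_mult_distrib)
    then have "inner geometric (parabola p q ?u t) =
        inner geometric (p + t *\<^sub>R (q - p)) - t * (1 - t) * 2 ^ n"
      unfolding parabola_def inner_diff_right[of _ "_ + _"] by (metis inner_scaleR_right)
    \<comment> \<open>The square root in the length halves the exponent, whence
      \<open>2 ^ n / 2\<close>.\<close>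
    with 1 have A: "exp (inner geometric (parabola p q ?u t) / 2) \<le>
        exp (norm geometric * (norm p + norm (q - p)) / 2) * exp (- (2 ^ n / 2 * (t * (1 - t))))"
      unfolding exp_add[symmetric] by (simp add: field_simps)
    have u: "damp ?u = unit_vec n"
      by (simp add: linear_scale[OF bounded_linear.linear[OF bounded_linear_damp]] damp_unit_vec
          flip: power_mult_distrib)
    interpret damp: bounded_linear damp by (rule bounded_linear_damp)
    have "damp (?v t) = damp (q - p) - (1 - 2 * t) *\<^sub>R unit_vec n"
      unfolding damp.diff[of "q - p"] damp.scale[of "1 - 2 * t"] u ..
    then have "norm (damp (?v t)) \<le> norm (damp (q - p)) + norm ((1 - 2 * t) *\<^sub>R unit_vec n)"
      using norm_triangle_ineq4 by metis
    \<comment> \<open>The summand 1 bounds \<open>\<bar>1 - 2 * t\<bar>\<close> on the unit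
      interval.\<close>
    also have "\<dots> \<le> norm (q - p) + 1"
      using t by (intro add_mono norm_damp_le) (auto simp: norm_unit_vec)
    finally have B: "norm (damp (?v t)) \<le> norm (q - p) + 1" .
    show "?h t \<le> ?K * exp (- (2 ^ n / 2 * (t * (1 - t))))"
      using mult_mono[OF A B] by (simp add: mult_ac)
  qed
  finally show ?thesis by simp
qed

text \<open>The infimum lies below the length of every detour, and these lengths are at most
  \<open>?K * ?I n\<close>, which tends to 0 because \<open>?K\<close> is independent of
  \<open>n\<close>. Nonnegativity of lengths gives the other inequality.\<close>

lemma geodesic_dist_exp_metric: "geodesic_dist exp_metric p q = 0"
proof (rule antisym)
  let ?K = "exp (norm geometric * (norm p + norm (q - p)) / 2) * (norm (q - p) + 1)"
  let ?I = "\<lambda>n. integral {0..1} (\<lambda>t. exp (- (2 ^ n / 2 * (t * (1 - t))))) :: real"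
  have "filterlim (\<lambda>n. 2 ^ n :: real) at_top sequentially"
    using filterlim_at_infinity_imp_norm_at_top[OF filterlim_realpow_sequentially_gt1[of "2 :: real"]]
    by (simp add: norm_power)
  from filterlim_tendsto_pos_mult_at_top[OF tendsto_const[of "1 / 2"] _ this]
  have "filterlim (\<lambda>n. 2 ^ n / 2 :: real) at_top sequentially"
    by simp
  then have "?I \<longlonglongrightarrow> 0"
    by (rule integral_exp_parabola_tendsto_0) simp
  then have lim: "(\<lambda>n. ?K * ?I n) \<longlonglongrightarrow> 0"
    by (rule tendsto_mult_right_zero)
  have "geodesic_dist exp_metric p q \<le> ?K * ?I n" for n
    unfolding geodesic_dist_def
    by (intro order_trans[OF _ curve_length_parabola_le] cINF_lower
        bdd_below_curve_length weak_riemannian_metric_exp_metric parabola_in_piecewise_smooth_paths)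
  then show "geodesic_dist exp_metric p q \<le> 0"
    by (intro LIMSEQ_le_const[OF lim]) blast
  show "0 \<le> geodesic_dist exp_metric p q"
    unfolding geodesic_dist_def
    \<comment> \<open>The segment shows that the class of curves is nonempty, as a lower bound on
      the infimum requires.\<close>
    using linepath_in_piecewise_smooth_paths
    by (intro cINF_greatest curve_length_nonneg weak_riemannian_metric_exp_metric) blast
qed

theorem mainTheorem1:
  shows "\<exists>g :: ell2 \<Rightarrow> ell2 \<Rightarrow>\<^sub>L ell2 \<Rightarrow>\<^sub>L real.
    weak_riemannian_metric g \<and> (\<forall>p q. geodesic_dist g p q = 0)"
  using weak_riemannian_metric_exp_metric geodesic_dist_exp_metric by blast

end
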